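(* Let $(T,X)$ be a minimal invertible semiflow on a nonempty compact Hausdorff space $X$ with $T$ abelian, $S$ a syndetic subsemigroup of $T$, and $x\in X$. Then $x\in P_{aa}(T,X)$ if and only if $x\in P_{aa}(S,X)$.
   Context: $T$ is a topological semigroup with identity $e$. A semiflow $(T,X)$ is a jointly continuous map $T\times X\to X$, $(t,x)\mapsto tx$, with $ex=x$ and $t(sx)=(ts)x$. It is minimal if every orbit $Tx$ is dense in $X$, and invertible if each transition $x\mapsto tx$, $t\in T$, is a bijection of $X$. $(S,X)$ denotes the restriction of the action to $S$. A set $A\subseteq T$ is syndetic in $T$ if there is a compact $K\subseteq T$ with $Kt\cap A\ne\emptyset$ for all $t\in T$. $x\in P_{aa}(T,X)$ (almost automorphic point) if for every net $\{t_n\}$ in $T$ and net $\{x_n'\}$ in $X$: $t_nx\to y$, $x_n'\to x'$ and $t_nx_n'=y$ for all $n$ imply $x=x'$; $P_{aa}(S,X)$ is defined in the same way with nets in $S$. *)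

theory Defs
  imports "HOL-Analysis.Analysis"
begin

definition directed_on :: "'i set \<Rightarrow> ('i \<Rightarrow> 'i \<Rightarrow> bool) \<Rightarrow> bool" where
  "directed_on D le \<longleftrightarrow> D \<noteq> {} \<and> (\<forall>a\<in>D. le a a) \<and>
     (\<forall>a\<in>D. \<forall>b\<in>D. \<forall>c\<in>D. le a b \<longrightarrow> le b c \<longrightarrow> le a c) \<and>
     (\<forall>a\<in>D. \<forall>b\<in>D. \<exists>c\<in>D. le a c \<and> le b c)"

text \<open>A net indexed by the directed set \<open>(D, le)\<close> is a function on \<open>D\<close>, represented by a
  function on the ambient type; it converges to \<open>l\<close> iff it tends to \<open>l\<close> along the filter
  generated by the tails of \<open>D\<close>.\<close>

definition net_filter :: "'i set \<Rightarrow> ('i \<Rightarrow> 'i \<Rightarrow> bool) \<Rightarrow> 'i filter" where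
  "net_filter D le = (INF a\<in>D. principal {b \<in> D. le a b})"

lemma eventually_net_filter:
  assumes "directed_on D le"
  shows "eventually P (net_filter D le) \<longleftrightarrow> (\<exists>a\<in>D. \<forall>b\<in>D. le a b \<longrightarrow> P b)"
  unfolding net_filter_def
proof (subst eventually_INF_base)
  show "D \<noteq> {}" using assms by (simp add: directed_on_def)
  fix a b assume ab: "a \<in> D" "b \<in> D"
  with assms obtain c where c: "c \<in> D" "le a c" "le b c"
    unfolding directed_on_def by blast
  moreover have "le a d" "le b d" if "d \<in> D" "le c d" for d
    using assms ab c that unfolding directed_on_def by blast+
  ultimately show "\<exists>c\<in>D. principal {d \<in> D. le c d}
      \<le> inf (principal {d \<in> D. le a d}) (principal {d \<in> D. le b d})"
    by (intro bexI[of _ c]) auto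
qed (auto simp: eventually_principal)

definition semiflow :: "('t::topological_monoid_mult \<Rightarrow> 'x::topological_space \<Rightarrow> 'x) \<Rightarrow> bool" where
  "semiflow act \<longleftrightarrow> continuous_on UNIV (\<lambda>(t, x). act t x) \<and>
     (\<forall>x. act 1 x = x) \<and> (\<forall>t s x. act t (act s x) = act (t * s) x)"

definition minimal_semiflow :: "('t \<Rightarrow> 'x::topological_space \<Rightarrow> 'x) \<Rightarrow> bool" where
  "minimal_semiflow act \<longleftrightarrow> (\<forall>x. closure (range (\<lambda>t. act t x)) = UNIV)"

definition invertible_semiflow :: "('t \<Rightarrow> 'x \<Rightarrow> 'x) \<Rightarrow> bool" where
  "invertible_semiflow act \<longleftrightarrow> (\<forall>t. bij (act t))"

definition subsemigroup :: "'t::semigroup_mult set \<Rightarrow> bool" where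
  "subsemigroup S \<longleftrightarrow> S \<noteq> {} \<and> (\<forall>s\<in>S. \<forall>t\<in>S. s * t \<in> S)"

definition syndetic :: "'t::topological_semigroup_mult set \<Rightarrow> bool" where
  "syndetic A \<longleftrightarrow> (\<exists>K. compact K \<and> (\<forall>t. (\<lambda>k. k * t) ` K \<inter> A \<noteq> {}))"

definition aa_for_nets_on ::
  "'i set \<Rightarrow> ('i \<Rightarrow> 'i \<Rightarrow> bool) \<Rightarrow> 't set \<Rightarrow> ('t \<Rightarrow> 'x::topological_space \<Rightarrow> 'x) \<Rightarrow> 'x \<Rightarrow> bool" where
  "aa_for_nets_on D le S act x \<longleftrightarrow>
     (\<forall>t x' y z.
        (\<forall>n\<in>D. t n \<in> S) \<longrightarrow>
        ((\<lambda>n. act (t n) x) \<longlongrightarrow> y) (net_filter D le) \<longrightarrow>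
        (x' \<longlongrightarrow> z) (net_filter D le) \<longrightarrow>
        (\<forall>n\<in>D. act (t n) (x' n) = y) \<longrightarrow>
        x = z)"

text \<open>The definition of an almost automorphic point quantifies over all nets. A formula of HOL
  cannot quantify over types, so the index sets are taken from one fixed type; by the lemma
  \<open>P_aa_nets\<close> below, the property then holds for nets indexed by directed sets in every type.\<close>

definition P_aa :: "'t set \<Rightarrow> ('t \<Rightarrow> 'x::topological_space \<Rightarrow> 'x) \<Rightarrow> 'x set" where
  "P_aa S act =
     {x. \<forall>(D :: (('t \<times> 'x) set \<times> ('t \<times> 'x)) set) le.
           directed_on D le \<longrightarrow> aa_for_nets_on D le S act x}"

lemma P_aa_nets:
  fixes D :: "'i set" and act :: "'t \<Rightarrow> 'x::topological_space \<Rightarrow> 'x"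
  assumes x: "x \<in> P_aa S act" and dir: "directed_on D le"
  shows "aa_for_nets_on D le S act x"
  unfolding aa_for_nets_on_def
proof (intro allI impI)
  fix t x' y z
  assume tS: "\<forall>n\<in>D. t n \<in> S"
    and ty: "((\<lambda>n. act (t n) x) \<longlongrightarrow> y) (net_filter D le)"
    and xz: "(x' \<longlongrightarrow> z) (net_filter D le)"
    and eq: "\<forall>n\<in>D. act (t n) (x' n) = y"
  define p where "p n = (t n, x' n)" for n
  define B where "B n = p ` {m \<in> D. le n m}" for n
  define E where "E = {(B n, p m) |n m. n \<in> D \<and> m \<in> D \<and> le n m}"
  define leE where "leE a b \<longleftrightarrow> fst b \<subseteq> fst a"
    for a b :: "('t \<times> 'x) set \<times> ('t \<times> 'x)"
  have refl: "le n n" if "n \<in> D" for n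
    using dir that unfolding directed_on_def by blast
  have mono: "B m \<subseteq> B n" if "n \<in> D" "m \<in> D" "le n m" for n m
    using dir that unfolding directed_on_def B_def by blast
  have E: "(B n, p n) \<in> E" if "n \<in> D" for n
    using that refl[OF that] unfolding E_def by blast
  have dirE: "directed_on E leE"
    unfolding directed_on_def
  proof (intro conjI ballI impI)
    show "E \<noteq> {}" using E dir unfolding directed_on_def by blast
    fix a b assume "a \<in> E" "b \<in> E"
    then obtain n m where nm: "n \<in> D" "fst a = B n" "m \<in> D" "fst b = B m"
      unfolding E_def by force
    obtain k where k: "k \<in> D" "le n k" "le m k"
      using dir nm unfolding directed_on_def by blast
    show "\<exists>c\<in>E. leE a c \<and> leE b c"
      using E[OF k(1)] mono[OF nm(1) k(1,2)] mono[OF nm(3) k(1,3)] nm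
      by (intro bexI[of _ "(B k, p k)"]) (auto simp: leE_def)
  qed (auto simp: leE_def)
  have ev: "eventually (\<lambda>a. Q (snd a)) (net_filter E leE)"
    if Q: "eventually (\<lambda>n. Q (p n)) (net_filter D le)" for Q
  proof -
    obtain n where n: "n \<in> D" "\<And>m. m \<in> D \<Longrightarrow> le n m \<Longrightarrow> Q (p m)"
      using Q unfolding eventually_net_filter[OF dir] by blast
    have "Q (snd b)" if b: "b \<in> E" "leE (B n, p n) b" for b
    proof -
      have "snd b \<in> fst b" using b(1) unfolding E_def B_def by force
      then have "snd b \<in> B n" using b(2) unfolding leE_def by auto
      then show ?thesis using n(2) unfolding B_def by auto
    qed
    then show ?thesis
      unfolding eventually_net_filter[OF dirE] using E[OF n(1)] by blast
  qed
  have "((\<lambda>a. act (fst (snd a)) x) \<longlongrightarrow> y) (net_filter E leE)"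
    using ty unfolding tendsto_def
    by (intro allI impI ev[where Q = "\<lambda>q. act (fst q) x \<in> U" for U]) (auto simp: p_def)
  moreover have "((\<lambda>a. snd (snd a)) \<longlongrightarrow> z) (net_filter E leE)"
    using xz unfolding tendsto_def
    by (intro allI impI ev[where Q = "\<lambda>q. snd q \<in> U" for U]) (auto simp: p_def)
  moreover have "\<forall>a\<in>E. fst (snd a) \<in> S" "\<forall>a\<in>E. act (fst (snd a)) (snd (snd a)) = y"
    using tS eq unfolding E_def p_def by auto
  moreover have "aa_for_nets_on E leE S act x"
    using x dirE unfolding P_aa_def by blast
  ultimately show "x = z"
    unfolding aa_for_nets_on_def
    by (elim allE[of _ "\<lambda>a. fst (snd a)"] allE[of _ "\<lambda>a. snd (snd a)"] allE[of _ y] allE[of _ z]) blast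
qed

end

(* A net t_n in T is pushed into S by k_n t_n = s_n with k_n in the compact set K; along a finer
   filter k_n tends to some k.  If t_n x tends to y and t_n x'_n = y with x'_n tending to z, then
   s_n x tends to k y, and w_n = k_n^{-1} k x'_n satisfies s_n w_n = k y because T is abelian.  Any
   cluster point w of w_n has k w = k z, hence w = z.  So z arises from a net in S as well. *)

theory Submission
  imports Defs
begin

lemma net_of_filter:
  fixes F :: "'i filter"
  assumes F: "F \<noteq> bot" and P: "eventually P F"
  obtains D :: "('i set \<times> 'i) set" and le
  where "directed_on D le" "\<And>a. a \<in> D \<Longrightarrow> P (snd a)" "filterlim snd F (net_filter D le)"
proof
  define D where "D = {(A, a). eventually (\<lambda>n. n \<in> A) F \<and> a \<in> A \<and> (\<forall>n\<in>A. P n)}"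
  define le where "le a b \<longleftrightarrow> fst b \<subseteq> fst a" for a b :: "'i set \<times> 'i"
  have tail: "\<exists>a. (A, a) \<in> D" if A: "eventually (\<lambda>n. n \<in> A) F" "\<forall>n\<in>A. P n" for A
  proof -
    obtain a where "a \<in> A" using eventually_happens'[OF F A(1)] by blast
    with A have "(A, a) \<in> D" by (simp add: D_def)
    then show ?thesis ..
  qed
  show dir: "directed_on D le"
    unfolding directed_on_def
  proof (intro conjI ballI impI)
    show "D \<noteq> {}" using tail[of "{n. P n}"] P by fastforce
  next
    fix a b assume "a \<in> D" "b \<in> D"
    then have "eventually (\<lambda>n. n \<in> fst a \<inter> fst b) F" "\<forall>n\<in>fst a \<inter> fst b. P n"
      by (auto simp: D_def eventually_conj)
    from tail[OF this] obtain c where "(fst a \<inter> fst b, c) \<in> D" ..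
    then show "\<exists>c\<in>D. le a c \<and> le b c"
      by (rule rev_bexI) (simp add: le_def)
  qed (auto simp: le_def)
  show "P (snd a)" if "a \<in> D" for a
    using that by (auto simp: D_def)
  show "filterlim snd F (net_filter D le)"
    unfolding filterlim_iff
  proof (intro allI impI)
    fix Q assume Q: "eventually Q F"
    \<comment> \<open>This member of \<open>F\<close> gives the tail: an index beyond it has a
      smaller set, so its point satisfies \<open>Q\<close>.\<close>
    have "eventually (\<lambda>n. n \<in> {n. P n \<and> Q n}) F"
      using P Q by (simp add: eventually_conj)
    from tail[OF this] obtain a where a: "({n. P n \<and> Q n}, a) \<in> D"
      by auto
    have "Q (snd b)" if "b \<in> D" "le ({n. P n \<and> Q n}, a) b" for b
    proof -
      have "snd b \<in> fst b" using that(1) by (auto simp: D_def)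
      with that(2) show ?thesis by (auto simp: le_def)
    qed
    with a show "eventually (\<lambda>b. Q (snd b)) (net_filter D le)"
      unfolding eventually_net_filter[OF dir] by blast
  qed
qed

text \<open>Feeding both eventual conditions to \<open>net_of_filter\<close> as its \<open>P\<close>
  makes them hold at every index, as the definition demands. Passing to a subnet thus becomes
  passing to a finer filter.\<close>

lemma P_aa_filter:
  assumes x: "x \<in> P_aa S act" and F: "F \<noteq> bot"
    and S: "\<forall>\<^sub>F n in F. t n \<in> S"
    and y: "((\<lambda>n. act (t n) x) \<longlongrightarrow> y) F"
    and z: "(x' \<longlongrightarrow> z) F"
    and eq: "\<forall>\<^sub>F n in F. act (t n) (x' n) = y"
  shows "x = z"
proof (rule net_of_filter[OF F eventually_conj[OF S eq]])
  fix D le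
  assume D: "directed_on D le"
      "\<And>a. a \<in> D \<Longrightarrow> t (snd a) \<in> S \<and> act (t (snd a)) (x' (snd a)) = y"
      "filterlim snd F (net_filter D le)"
  have "((\<lambda>a. act (t (snd a)) x) \<longlongrightarrow> y) (net_filter D le)"
    "((\<lambda>a. x' (snd a)) \<longlongrightarrow> z) (net_filter D le)"
    using filterlim_compose[OF y D(3)] filterlim_compose[OF z D(3)] by simp_all
  moreover have "\<forall>a\<in>D. t (snd a) \<in> S" "\<forall>a\<in>D. act (t (snd a)) (x' (snd a)) = y"
    using D(2) by blast+
  ultimately show ?thesis
    using P_aa_nets[OF x D(1), unfolded aa_for_nets_on_def, rule_format,
        of "\<lambda>a. t (snd a)" y "\<lambda>a. x' (snd a)" z]
    by blast
qed

text \<open>The filter form of choosing a convergent subnet: \<open>l\<close> is a cluster point of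
  the image filter, and \<open>F\<close> is refined by the preimages of the neighbourhoods of
  \<open>l\<close>.\<close>

lemma compact_obtains_finer_limit:
  assumes K: "compact K" and F: "F \<noteq> bot" and f: "\<forall>\<^sub>F n in F. f n \<in> K"
  obtains G l where "G \<le> F" "G \<noteq> bot" "l \<in> K" "(f \<longlongrightarrow> l) G"
proof -
  have "\<forall>\<^sub>F v in filtermap f F. v \<in> K" "filtermap f F \<noteq> bot"
    using F f by (auto simp: eventually_filtermap filtermap_bot_iff)
  with iffD1[OF compact_filter K] obtain l where l: "l \<in> K" "inf (nhds l) (filtermap f F) \<noteq> bot"
    by blast
  \<comment> \<open>If the refinement were trivial, some neighbourhood of \<open>l\<close> would be
    avoided eventually along \<open>F\<close>, contradicting that \<open>l\<close> is a cluster
    point.\<close>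
  have "inf F (filtercomap f (nhds l)) \<noteq> bot"
  proof
    assume "inf F (filtercomap f (nhds l)) = bot"
    then obtain P Q where PQ: "eventually P F" "eventually Q (nhds l)" "\<And>n. P n \<Longrightarrow> Q (f n) \<Longrightarrow> False"
      unfolding trivial_limit_def eventually_inf eventually_filtercomap by blast
    have "eventually (\<lambda>v. \<not> Q v) (filtermap f F)"
      unfolding eventually_filtermap using PQ(1) by eventually_elim (use PQ(3) in blast)
    with PQ(2) have "inf (nhds l) (filtermap f F) = bot"
      unfolding trivial_limit_def eventually_inf by blast
    with l(2) show False by contradiction
  qed
  moreover have "(f \<longlongrightarrow> l) (inf F (filtercomap f (nhds l)))"
    using filterlim_filtercomap by (rule filterlim_mono) auto
  ultimately show thesis
    using that l(1) by (metis inf_le1)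
qed

lemma semiflow_tendsto:
  assumes "semiflow act" "(f \<longlongrightarrow> t) F" "(g \<longlongrightarrow> x) F"
  shows "((\<lambda>n. act (f n) (g n)) \<longlongrightarrow> act t x) F"
proof (rule topological_tendstoI)
  fix U assume "open U" "act t x \<in> U"
  moreover from \<open>open U\<close> have "open ((\<lambda>(t, x). act t x) -` U)"
    using assms(1) unfolding semiflow_def by (metis open_vimage)
  ultimately show "\<forall>\<^sub>F n in F. act (f n) (g n) \<in> U"
    using topological_tendstoD[OF tendsto_Pair[OF assms(2,3)]] by fastforce
qed

text \<open>Every net in \<open>S\<close> is a net in \<open>S'\<close>, so the smaller set imposes
  fewer conditions.\<close>

lemma P_aa_antimono:
  fixes act :: "'a \<Rightarrow> 'b::topological_space \<Rightarrow> 'b"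
  shows "S \<subseteq> S' \<Longrightarrow> P_aa S' act \<subseteq> P_aa S act"
proof
  fix x assume "S \<subseteq> S'" and x: "x \<in> P_aa S' act"
  have "aa_for_nets_on D le S act x" if "aa_for_nets_on D le S' act x"
    for D :: "(('a \<times> 'b) set \<times> ('a \<times> 'b)) set" and le
    unfolding aa_for_nets_on_def
  proof (intro allI impI)
    fix t x' y z
    assume "\<forall>n\<in>D. t n \<in> S"
    with \<open>S \<subseteq> S'\<close> have "\<forall>n\<in>D. t n \<in> S'" by blast
    moreover assume "((\<lambda>n. act (t n) x) \<longlongrightarrow> y) (net_filter D le)"
      "(x' \<longlongrightarrow> z) (net_filter D le)" "\<forall>n\<in>D. act (t n) (x' n) = y"
    ultimately show "x = z"
      using that[unfolded aa_for_nets_on_def, rule_format, of t y x' z] by blast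
  qed
  with x show "x \<in> P_aa S act"
    unfolding P_aa_def by blast
qed

lemma P_aa_syndetic:
  fixes act :: "'t::topological_comm_monoid_mult \<Rightarrow> 'x::t2_space \<Rightarrow> 'x"
  assumes compact: "compact (UNIV :: 'x set)"
    and semiflow: "semiflow act" and invertible: "invertible_semiflow act"
    and "syndetic S" and x: "x \<in> P_aa S act"
  shows "x \<in> P_aa UNIV act"
  unfolding P_aa_def mem_Collect_eq aa_for_nets_on_def
proof (intro allI impI)
  fix D :: "(('t \<times> 'x) set \<times> ('t \<times> 'x)) set" and le t x' y z
  assume dir: "directed_on D le"
    and y: "((\<lambda>n. act (t n) x) \<longlongrightarrow> y) (net_filter D le)"
    and z: "(x' \<longlongrightarrow> z) (net_filter D le)"
    and eq: "\<forall>n\<in>D. act (t n) (x' n) = y"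
  define F where "F = net_filter D le"
  \<comment> \<open>By reflexivity every tail contains its own starting index, so no tail is
    empty.\<close>
  have F: "F \<noteq> bot"
  proof
    assume "F = bot"
    then have "\<exists>a\<in>D. \<forall>b\<in>D. \<not> le a b"
      unfolding F_def trivial_limit_def eventually_net_filter[OF dir] by simp
    with dir show False unfolding directed_on_def by blast
  qed
  have ev: "\<forall>\<^sub>F n in F. act (t n) (x' n) = y"
    unfolding F_def
    using dir eq unfolding eventually_net_filter[OF dir] directed_on_def by blast
  have act_act: "act a (act b u) = act (a * b) u" for a b u
    using semiflow by (simp add: semiflow_def)
  have bij: "bij (act a)" for a
    using invertible by (simp add: invertible_semiflow_def)
  obtain K where K: "compact K" "\<And>a. \<exists>k\<in>K. k * a \<in> S"
    using \<open>syndetic S\<close> unfolding syndetic_def by blast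
  obtain k where k: "\<And>n. k n \<in> K" "\<And>n. k n * t n \<in> S"
    using choice[of "\<lambda>n k. k \<in> K \<and> k * t n \<in> S"] K(2) by blast
  have "\<forall>\<^sub>F n in F. k n \<in> K" using k(1) by simp
  then obtain G l where G: "G \<le> F" "G \<noteq> bot" "l \<in> K" "(k \<longlongrightarrow> l) G"
    by (rule compact_obtains_finer_limit[OF K(1) F])
  \<comment> \<open>The correcting factor \<open>k n\<close> changes the target from
    \<open>y\<close> to \<open>act (k n) y\<close>, which varies with \<open>n\<close>. The points
    \<open>w n\<close> compensate for this, making the target the constant
    \<open>act l y\<close>.\<close>
  define w where "w n = inv (act (k n)) (act l (x' n))" for n
  have w: "act (k n) (w n) = act l (x' n)" for n
    unfolding w_def using bij by (simp add: bij_is_surj surj_f_inv_f)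
  \<comment> \<open>Continuity of the inverse transitions in \<open>k n\<close> is not at hand, so a
    limit of \<open>w\<close> comes from compactness of the space, by a second refinement.\<close>
  have "\<forall>\<^sub>F n in G. w n \<in> UNIV" by simp
  then obtain H v where H: "H \<le> G" "H \<noteq> bot" "v \<in> UNIV" "(w \<longlongrightarrow> v) H"
    by (rule compact_obtains_finer_limit[OF compact G(2)])
  have HF: "H \<le> F" using H(1) G(1) by simp
  have kl: "(k \<longlongrightarrow> l) H" using tendsto_mono[OF H(1) G(4)] .
  have xz: "(x' \<longlongrightarrow> z) H" and ty: "((\<lambda>n. act (t n) x) \<longlongrightarrow> y) H"
    using y z HF unfolding F_def by (auto intro: tendsto_mono)
  \<comment> \<open>Both sides are limits along \<open>H\<close> of
    \<open>act (k n) (w n) = act l (x' n)\<close>, and limits are unique in a Hausdorff space.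
    Injectivity of \<open>act l\<close> then identifies \<open>v\<close> with
    \<open>z\<close>.\<close>
  have "act l v = act l z"
    using tendsto_unique[OF H(2) semiflow_tendsto[OF semiflow kl H(4)]]
      semiflow_tendsto[OF semiflow tendsto_const xz] by (simp add: w)
  then have "v = z"
    using bij by (metis bij_is_inj injD)
  \<comment> \<open>The hypothesis on \<open>S\<close> is applied to the elements
    \<open>k n * t n\<close> and the points \<open>w n\<close>, with common image
    \<open>act l y\<close>.\<close>
  moreover have "x = v"
  proof (rule P_aa_filter[OF x H(2) _ _ H(4)])
    show "\<forall>\<^sub>F n in H. k n * t n \<in> S" using k(2) by simp
    show "((\<lambda>n. act (k n * t n) x) \<longlongrightarrow> act l y) H"
      using semiflow_tendsto[OF semiflow kl ty] by (simp add: act_act)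
    show "\<forall>\<^sub>F n in H. act (k n * t n) (w n) = act l y"
      using filter_leD[OF HF ev]
    proof eventually_elim
      case (elim n)
      \<comment> \<open>Commutativity is used twice: to let \<open>k n\<close> act first, where the
        equation for \<open>w n\<close> applies, and then to move \<open>l\<close> outside
        \<open>t n\<close>.\<close>
      have "act (k n * t n) (w n) = act (t n) (act (k n) (w n))"
        by (simp add: act_act mult.commute)
      also have "\<dots> = act l (act (t n) (x' n))"
        by (simp add: w) (simp add: act_act mult.commute)
      finally show ?case using elim by simp
    qed
  qed
  ultimately show "x = z" by simp
qed

theorem corollary0p16:
  fixes act :: "'t::topological_comm_monoid_mult \<Rightarrow> 'x::t2_space \<Rightarrow> 'x"
    and S :: "'t set" and x :: 'x
  assumes "compact (UNIV :: 'x set)"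
    and "semiflow act"
    and "minimal_semiflow act"
    and "invertible_semiflow act"
    and "subsemigroup S"
    and "syndetic S"
  shows "x \<in> P_aa UNIV act \<longleftrightarrow> x \<in> P_aa S act"
  using P_aa_syndetic[OF assms(1,2,4,6)] P_aa_antimono[of S UNIV act] by blast

end
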